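(* The number $C_n^{\langle k\rangle}$ of compositions of $n$ with no run of $k$ equal parts satisfies $$C_n^{\langle k\rangle}=\rho_k^{-n-1}(1-\rho_k)^2\left(1+\epsilon(k)\right)+O\left(\left(\frac53\right)^n\right),\qquad n\to\infty,$$ uniformly with respect to integers $k\ge4$ (the implied constant does not depend on $k$), where $\epsilon(k)$ is a quantity depending only on $k$ with $\epsilon(k)=O(k2^{-k})$ as $k\to\infty$.
   Context: A composition of size $n$ is a finite sequence of positive integers (the parts) with sum $n$; the empty sequence is the composition of size $0$. $C_n^{\langle k\rangle}$ is the number of compositions of $n$ in which no part appears $k$ times consecutively, and $C^{\langle k\rangle}(z)=\sum_{n\ge0}C_n^{\langle k\rangle}z^n$ is the generating function, given by $$C^{\langle k\rangle}(z)=\left(1-\sum_{j=1}^\infty z^j\frac{1-z^{j(k-1)}}{1-z^{jk}}\right)^{-1}.$$ $\rho_k$ denotes the dominant (smallest modulus) positive singularity of $C^{\langle k\rangle}(z)$, i.e. the smallest positive real solution of $\sum_{j\ge1} z^j\frac{1-z^{j(k-1)}}{1-z^{jk}}=1$; it exists and satisfies $\frac12<\rho_k<\frac35$. *)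

theory Defs
  imports Complex_Main "HOL-Library.Sublist" "HOL-Library.Landau_Symbols"
begin

definition compositions :: "nat \<Rightarrow> nat list set" where
  "compositions n = {xs. (\<forall>x\<in>set xs. 0 < x) \<and> sum_list xs = n}"

text \<open>\<open>sublist\<close> is the contiguous-sublist relation, so this forbids \<open>k\<close> consecutive equal parts.\<close>

definition run_free_count :: "nat \<Rightarrow> nat \<Rightarrow> nat" where
  "run_free_count k n = card {xs \<in> compositions n. \<forall>a. \<not> sublist (replicate k a) xs}"

text \<open>
  The generating function of \<open>run_free_count k\<close> is \<open>1 / (1 - S)\<close>, where \<open>S\<close> is the sum over
  \<open>j \<ge> 1\<close> of the terms \<open>part_gf k j z\<close>; its smallest positive singularity is the smallest
  positive solution of \<open>S = 1\<close>. Since \<open>sums\<close> includes convergence, points where the series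
  diverges are not counted as solutions.
\<close>

definition part_gf :: "nat \<Rightarrow> nat \<Rightarrow> real \<Rightarrow> real" where
  "part_gf k j z = z ^ j * ((1 - z ^ (j * (k - 1))) / (1 - z ^ (j * k)))"

definition rho :: "nat \<Rightarrow> real" where
  "rho k = (LEAST z. 0 < z \<and> (\<lambda>j. part_gf k (Suc j) z) sums 1)"

end

theory Submission
  imports Defs "HOL-Analysis.Uniform_Limit" "HOL-Computational_Algebra.Formal_Power_Series"
begin

text \<open>
  Write \<open>C\<close> for the generating function of the counts and \<open>r = rho k\<close>. Since \<open>part_gf k j z\<close> equals
  \<open>z\<^sup>j\<close> minus a small defect of size about \<open>z\<^sup>j\<^sup>k\<close>, multiplying \<open>1 / C\<close> by \<open>1 - X\<close> gives
  \<open>1 - 2 X + e\<close>, where \<open>e\<close> is the sum over \<open>j\<close> of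
  \<open>part_defect k j = (1 - X) (1 - X\<^sup>j) X\<^sup>j\<^sup>k / (1 - X\<^sup>j\<^sup>k)\<close>. This function vanishes at \<open>r\<close>. Subtracting
  from each of its terms the value at \<open>r\<close> and dividing by \<open>X - r\<close> turns it into \<open>(r - X) (2 - D)\<close>, where \<open>D\<close> is the sum of
  the divided differences of the summands of \<open>e\<close>.

  That \<open>r\<close> is the only singularity in the disc of radius \<open>3/5\<close> is a norm estimate: in
  the weighted norm that sends \<open>p\<close> to the sum of \<open>\<bar>p\<^sub>n\<bar> s\<^sup>n\<close>, a submultiplicative norm, the series \<open>D\<close> has
  norm at most \<open>13/10\<close> for \<open>s = 3/5\<close> and every \<open>k \<ge> 4\<close>. So \<open>2 - D\<close> is invertible by a Neumann
  series, with a bound on the inverse that does not depend on \<open>k\<close> (\<open>gf_factorization\<close>).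
  Hence \<open>C = K / (r - X)\<close>, where \<open>K = (1 - X) / (2 - D)\<close> has norm at most \<open>12/5\<close>. The coefficient of
  \<open>X\<^sup>n\<close> in \<open>C\<close> is \<open>r powi (- n - 1)\<close> times a partial sum of \<open>K\<close> evaluated at \<open>r\<close>; replacing the partial
  sum by \<open>K(r)\<close> costs a tail, which is \<open>O((5/3)\<^sup>n)\<close> because \<open>r \<le> 3/5\<close>.

  The constant follows from the same norm taken at \<open>s = r\<close>: there \<open>D\<close> has norm \<open>O(k r\<^sup>k)\<close>, so
  \<open>K(r) = (1 - r) / 2 + O(k r\<^sup>k)\<close>. Since \<open>2 r - 1 \<le> r\<^sup>k\<close>, the root is so close to \<open>1/2\<close> that
  \<open>r\<^sup>k = O(2 powi (- k))\<close>, and \<open>(1 - r) / 2\<close> may be replaced by \<open>(1 - r)\<^sup>2\<close>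
  (\<open>run_free_count_asymptotics\<close>).
\<close>

unbundle no vec_syntax
unbundle fps_syntax

section \<open>Counting compositions by their first part\<close>

definition run_free :: "nat \<Rightarrow> nat list \<Rightarrow> bool" where
  "run_free k xs \<longleftrightarrow> (\<forall>a. \<not> sublist (replicate k a) xs)"

definition run_free_compositions :: "nat \<Rightarrow> nat \<Rightarrow> nat list set" where
  "run_free_compositions k n = {xs \<in> compositions n. run_free k xs}"

text \<open>
  What remains of the compositions with first part \<open>j\<close> after that part is removed; keeping the tails
  lets a composition be extended by one part at a time.
\<close>

definition run_free_tails :: "nat \<Rightarrow> nat \<Rightarrow> nat \<Rightarrow> nat list set" where
  "run_free_tails k j n = {ys. j # ys \<in> run_free_compositions k n}"

lemma length_le_sum_list_pos: "\<forall>x\<in>set xs. 0 < (x::nat) \<Longrightarrow> length xs \<le> sum_list xs"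
  by (induction xs) auto

lemma finite_run_free_compositions: "finite (run_free_compositions k n)"
proof -
  have "run_free_compositions k n \<subseteq> {xs. set xs \<subseteq> {..n} \<and> length xs \<le> n}"
    using member_le_sum_list length_le_sum_list_pos
    by (fastforce simp: run_free_compositions_def compositions_def)
  then show ?thesis
    using finite_lists_length_le[of "{..n}" n] finite_subset by auto
qed

lemma finite_run_free_tails: "finite (run_free_tails k j n)"
proof -
  have "Cons j ` run_free_tails k j n \<subseteq> run_free_compositions k n"
    by (auto simp: run_free_tails_def)
  then show ?thesis
    using finite_run_free_compositions finite_subset finite_imageD by (metis inj_on_Cons1)
qed

lemma run_free_Cons:
  "run_free (Suc k) (j # ys) \<longleftrightarrow> run_free (Suc k) ys \<and> \<not> prefix (replicate k j) ys"
  by (auto simp: run_free_def sublist_Cons_right)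

text \<open>
  A run of \<open>j\<close> that is longer than the block of \<open>j\<close> standing in front has to continue into the rest.
\<close>

lemma prefix_replicate_append_imp_Cons:
  "prefix (replicate p j) (replicate i j @ zs) \<Longrightarrow> i < p \<Longrightarrow> \<exists>zs'. zs = j # zs'"
proof (induction i arbitrary: p)
  case 0
  then show ?case by (cases p) (auto simp: prefix_def)
next
  case (Suc i)
  then show ?case by (cases p) auto
qed

lemma run_free_replicate_append:
  assumes "run_free (Suc k) zs" and "\<And>zs'. zs \<noteq> j # zs'" and "i \<le> k"
  shows "run_free (Suc k) (replicate i j @ zs)"
  using assms(3)
proof (induction i)
  case 0
  then show ?case using assms by simp
next
  case (Suc i)
  then show ?case
    using prefix_replicate_append_imp_Cons[of k j i zs] assms(2) by (auto simp: run_free_Cons)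
qed

lemma run_free_append_right: "run_free k (xs @ ys) \<Longrightarrow> run_free k ys"
  using sublist_append[of _ xs ys] by (auto simp: run_free_def)

text \<open>
  The longest admissible block of \<open>j\<close> can be put in front of exactly those lists that do not start
  with \<open>j\<close>.
\<close>

lemma run_free_replicate_append_iff:
  "run_free (Suc k) (replicate k j @ zs) \<longleftrightarrow> run_free (Suc k) zs \<and> (\<forall>zs'. zs \<noteq> j # zs')"
proof
  assume L: "run_free (Suc k) (replicate k j @ zs)"
  have "zs \<noteq> j # zs'" for zs'
  proof
    assume "zs = j # zs'"
    then have "replicate k j @ zs = replicate (Suc k) j @ zs'"
      by (simp add: replicate_app_Cons_same)
    then show False
      using L unfolding run_free_def by (metis prefixI prefix_imp_sublist)
  qed
  then show "run_free (Suc k) zs \<and> (\<forall>zs'. zs \<noteq> j # zs')"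
    using L run_free_append_right[OF L] by simp
qed (use run_free_replicate_append[of k zs j k] in simp)

text \<open>
  A forbidden run in \<open>j # ys\<close> that is not already in \<open>ys\<close> can only be the initial one, so \<open>ys\<close> then starts
  with exactly \<open>k\<close> copies of \<open>j\<close> (the forbidden length being \<open>Suc k\<close>). Removing this block leaves a
  run-free composition that does not start with \<open>j\<close>; counting these gives a recursion of step \<open>j * Suc k\<close>.
  The second claim makes the subtraction of natural numbers in the first one exact.
\<close>

lemma card_run_free_tails:
  fixes k j n :: nat
  assumes "0 < j" "j \<le> n"
  defines "m \<equiv> n - j * Suc k"
  shows "card (run_free_tails (Suc k) j n)
           + (if j * Suc k \<le> n then card (run_free_compositions (Suc k) m) - card (run_free_tails (Suc k) j m) else 0)
         = card (run_free_compositions (Suc k) (n - j))"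
    and "card (run_free_tails (Suc k) j m) \<le> card (run_free_compositions (Suc k) m)"
proof -
  let ?F = "run_free_compositions (Suc k)" and ?T = "run_free_tails (Suc k) j"
  let ?P = "{ys \<in> ?F (n - j). prefix (replicate k j) ys}"
  have T: "?T n = ?F (n - j) - ?P"
    using assms(1,2) by (auto simp: run_free_tails_def run_free_compositions_def compositions_def run_free_Cons)
  have img: "Cons j ` ?T m \<subseteq> ?F m"
    by (auto simp: run_free_tails_def)
  have cimg: "card (Cons j ` ?T m) = card (?T m)"
    by (simp add: card_image)
  show le: "card (?T m) \<le> card (?F m)"
    using card_mono[OF finite_run_free_compositions img] cimg by simp
  have P: "?P = (if j * Suc k \<le> n then append (replicate k j) ` (?F m - Cons j ` ?T m) else {})"
  proof (cases "j * Suc k \<le> n")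
    case True
    have nj: "n - j = k * j + m"
    proof -
      have "j * Suc k = j + k * j" by (simp add: mult.commute)
      then show ?thesis using True unfolding m_def by linarith
    qed
    have size: "replicate k j @ zs \<in> compositions (n - j) \<longleftrightarrow> zs \<in> compositions m" for zs
      using assms(1) unfolding nj by (auto simp: compositions_def sum_list_replicate)
    have "?P = append (replicate k j) ` (?F m - Cons j ` ?T m)"
    proof (intro equalityI subsetI)
      fix ys assume "ys \<in> ?P"
      then obtain zs where ys: "ys = replicate k j @ zs" and F: "ys \<in> ?F (n - j)"
        unfolding prefix_def by blast
      have "zs \<in> ?F m"
        using F run_free_append_right[of "Suc k" "replicate k j" zs]
        unfolding ys run_free_compositions_def by (simp add: size)
      moreover have "zs \<notin> Cons j ` ?T m"
        using F run_free_replicate_append_iff[of k j zs] by (auto simp: ys run_free_compositions_def)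
      ultimately show "ys \<in> append (replicate k j) ` (?F m - Cons j ` ?T m)"
        by (auto simp: ys)
    next
      fix ys assume "ys \<in> append (replicate k j) ` (?F m - Cons j ` ?T m)"
      then obtain zs where ys: "ys = replicate k j @ zs" and F: "zs \<in> ?F m" and N: "zs \<notin> Cons j ` ?T m"
        by auto
      have "zs \<noteq> j # zs'" for zs'
        using F N by (auto simp: run_free_tails_def)
      then have "run_free (Suc k) ys"
        using F run_free_replicate_append_iff[of k j zs] by (auto simp: ys run_free_compositions_def)
      then show "ys \<in> ?P"
        using F size[of zs] unfolding run_free_compositions_def ys by simp
    qed
    then show ?thesis using True by simp
  next
    case False
    have False if mem: "ys \<in> ?P" for ys
    proof -
      obtain zs where ys: "ys = replicate k j @ zs" and F: "ys \<in> ?F (n - j)"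
        using mem unfolding prefix_def by blast
      have "k * j + sum_list zs = n - j"
        using F by (auto simp: ys run_free_compositions_def compositions_def sum_list_replicate)
      then have "j * Suc k \<le> n"
        using assms(2) by (simp add: mult.commute)
      then show False using False by simp
    qed
    then show ?thesis using False by auto
  qed
  have cP: "card ?P = (if j * Suc k \<le> n then card (?F m) - card (?T m) else 0)"
  proof (cases "j * Suc k \<le> n")
    case True
    have "card ?P = card (?F m - Cons j ` ?T m)"
      unfolding P using True by (simp add: card_image inj_on_def)
    then show ?thesis
      using True card_Diff_subset[OF _ img] finite_run_free_tails cimg by simp
  qed (simp add: P)
  have "card (?T n) + card ?P = card (?F (n - j))"
  proof -
    have "finite ?P" "?P \<subseteq> ?F (n - j)"
      using finite_run_free_compositions by auto
    then show ?thesis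
      unfolding T using card_mono[OF finite_run_free_compositions[of "Suc k" "n-j"], of ?P]
      by (simp add: card_Diff_subset)
  qed
  then show "card (?T n)
           + (if j * Suc k \<le> n then card (?F m) - card (?T m) else 0)
         = card (?F (n - j))"
    unfolding cP by simp
qed

definition gf :: "nat \<Rightarrow> real fps" where
  "gf k = Abs_fps (\<lambda>n. real (run_free_count k n))"

definition gf_from :: "nat \<Rightarrow> nat \<Rightarrow> real fps" where
  "gf_from k j = Abs_fps (\<lambda>n. real (card (run_free_tails k j n)))"

lemma gf_nth: "gf k $ n = real (card (run_free_compositions k n))"
  by (simp add: gf_def run_free_count_def run_free_compositions_def run_free_def)

text \<open>
  The compositions with first part \<open>j\<close> have generating function \<open>part_gf k j\<close> times that of all of
  them, here with the denominator cleared.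
\<close>

lemma gf_from_relation:
  assumes "0 < j" "0 < k"
  shows "(1 - fps_X ^ (j * k)) * gf_from k j = (fps_X ^ j - fps_X ^ (j * k)) * gf k"
proof (rule fps_ext)
  fix n
  obtain k' where k: "k = Suc k'" using assms(2) gr0_implies_Suc by auto
  have jk: "j \<le> j * k" using assms by simp
  show "((1 - fps_X ^ (j * k)) * gf_from k j) $ n = ((fps_X ^ j - fps_X ^ (j * k)) * gf k) $ n"
  proof (cases "n < j")
    case True
    then have "run_free_tails k j n = {}"
      by (auto simp: run_free_tails_def run_free_compositions_def compositions_def)
    moreover have "n < j * k"
      using True jk by linarith
    ultimately show ?thesis
      using True by (simp add: left_diff_distrib fps_X_power_mult_nth gf_nth gf_from_def)
  next
    case False
    note c = card_run_free_tails[of j n k', OF assms(1), folded k]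
    have "real (card (run_free_tails k j n)) + (if j * k \<le> n then real (card (run_free_compositions k (n - j * k)))
        - real (card (run_free_tails k j (n - j * k))) else 0) = real (card (run_free_compositions k (n - j)))"
      unfolding c(1)[symmetric, OF False[unfolded not_less]] using c(2) False
      by (simp add: of_nat_diff)
    then show ?thesis
      using False by (simp add: left_diff_distrib fps_X_power_mult_nth gf_nth gf_from_def split: if_splits)
  qed
qed

lemma card_run_free_compositions_eq_sum:
  assumes "0 < k"
  shows "card (run_free_compositions k n) = (if n = 0 then 1 else 0) + (\<Sum>j<n. card (run_free_tails k (Suc j) n))"
proof (cases "n = 0")
  case True
  have "run_free_compositions k 0 = {[]}"
    using assms by (auto simp: run_free_compositions_def compositions_def run_free_def)
      (metis list.set_intros(1) neq_Nil_conv neq0_conv)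
  then show ?thesis using True by simp
next
  case False
  have "run_free_compositions k n = (\<Union>j<n. Cons (Suc j) ` run_free_tails k (Suc j) n)"
  proof (intro equalityI subsetI)
    fix xs assume xs: "xs \<in> run_free_compositions k n"
    then obtain a ys where a: "xs = a # ys"
      using False by (cases xs) (auto simp: run_free_compositions_def compositions_def)
    then obtain j where j: "a = Suc j"
      using xs by (cases a) (auto simp: run_free_compositions_def compositions_def)
    have "j < n"
      using xs by (auto simp: a j run_free_compositions_def compositions_def)
    then show "xs \<in> (\<Union>j<n. Cons (Suc j) ` run_free_tails k (Suc j) n)"
      using xs by (auto simp: a j run_free_tails_def)
  qed (auto simp: run_free_tails_def)
  moreover have "card (\<Union>j<n. Cons (Suc j) ` run_free_tails k (Suc j) n)
      = (\<Sum>j<n. card (Cons (Suc j) ` run_free_tails k (Suc j) n))"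
    by (intro card_UN_disjoint) (auto simp: finite_run_free_tails)
  ultimately show ?thesis using False by (simp add: card_image)
qed

section \<open>Coefficientwise sums of power series\<close>

text \<open>
  Convergence of a series of power series, coefficient by coefficient in the real numbers. The metric on
  formal power series will not do, because the series below contain constants that tend to zero without
  vanishing.
\<close>

definition coeff_sums :: "(nat \<Rightarrow> real fps) \<Rightarrow> real fps \<Rightarrow> bool" where
  "coeff_sums f F \<longleftrightarrow> (\<forall>n. (\<lambda>j. f j $ n) sums (F $ n))"

lemma coeff_sums_mult:
  assumes "coeff_sums f F"
  shows "coeff_sums (\<lambda>j. f j * c) (F * c)"
  using assms unfolding coeff_sums_def fps_mult_nth by (intro allI sums_sum sums_mult2) auto

lemma coeff_sums_add: "coeff_sums f F \<Longrightarrow> coeff_sums g G \<Longrightarrow> coeff_sums (\<lambda>j. f j + g j) (F + G)"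
  by (auto simp: coeff_sums_def intro: sums_add)

lemma coeff_sums_diff: "coeff_sums f F \<Longrightarrow> coeff_sums g G \<Longrightarrow> coeff_sums (\<lambda>j. f j - g j) (F - G)"
  by (auto simp: coeff_sums_def intro: sums_diff)

lemma coeff_sums_const: "a sums A \<Longrightarrow> coeff_sums (\<lambda>j. fps_const (a j)) (fps_const A)"
  by (auto simp: coeff_sums_def)

lemma coeff_sums_unique: "coeff_sums f F \<Longrightarrow> coeff_sums f G \<Longrightarrow> F = G"
  by (auto simp: coeff_sums_def fps_eq_iff intro: sums_unique2)

lemma coeff_sums_gf_from:
  assumes "0 < k"
  shows "coeff_sums (\<lambda>j. gf_from k (Suc j)) (gf k - 1)"
  unfolding coeff_sums_def
proof
  fix n
  have "(\<lambda>j. gf_from k (Suc j) $ n) sums (\<Sum>j<n. gf_from k (Suc j) $ n)"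
    by (rule sums_finite)
      (auto simp: gf_from_def run_free_tails_def run_free_compositions_def compositions_def)
  moreover have "(\<Sum>j<n. gf_from k (Suc j) $ n) = (gf k - 1) $ n"
    using card_run_free_compositions_eq_sum[OF assms, of n] by (auto simp: gf_nth gf_from_def)
  ultimately show "(\<lambda>j. gf_from k (Suc j) $ n) sums ((gf k - 1) $ n)" by simp
qed

text \<open>
  The geometric series \<open>X / (1 - X)\<close>, multiplied by \<open>1 - X\<close>.
\<close>

lemma coeff_sums_telescope: "coeff_sums (\<lambda>j. fps_X ^ Suc j * (1 - fps_X)) fps_X"
proof -
  let ?G = "Abs_fps (\<lambda>n. if n = 0 then 0 else 1) :: real fps"
  have "coeff_sums (\<lambda>j. fps_X ^ Suc j) ?G"
    unfolding coeff_sums_def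
  proof
    fix n
    show "(\<lambda>j. fps_X ^ Suc j $ n) sums (?G $ n :: real)"
    proof (cases n)
      case 0
      then show ?thesis by (simp del: power_Suc add: fps_X_power_nth)
    next
      case (Suc m)
      then show ?thesis using sums_single[of m "\<lambda>_. 1::real"]
        by (simp del: power_Suc add: fps_X_power_nth eq_commute)
    qed
  qed
  from coeff_sums_mult[OF this, of "1 - fps_X"]
  have "coeff_sums (\<lambda>j. fps_X ^ Suc j * (1 - fps_X)) (?G * (1 - fps_X))" .
  moreover have "?G * (1 - fps_X) = fps_X"
  proof (rule fps_ext)
    fix n show "(?G * (1 - fps_X)) $ n = (fps_X :: real fps) $ n"
      by (simp add: right_diff_distrib fps_X_nth)
  qed
  ultimately show ?thesis by simp
qed

section \<open>Weighted norms of power series\<close>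

text \<open>
  The sum of \<open>\<bar>p\<^sub>n\<bar> s\<^sup>n\<close> is at most \<open>b\<close>. Partial sums express this without a separate convergence
  claim.
\<close>

definition wnorm_le :: "real \<Rightarrow> real fps \<Rightarrow> real \<Rightarrow> bool" where
  "wnorm_le s p b \<longleftrightarrow> (\<forall>N. (\<Sum>n<N. \<bar>p $ n\<bar> * s ^ n) \<le> b)"

lemma wnorm_leD: "wnorm_le s p b \<Longrightarrow> (\<Sum>n<N. \<bar>p $ n\<bar> * s ^ n) \<le> b"
  by (simp add: wnorm_le_def)

lemma wnorm_le_nonneg: "wnorm_le s p b \<Longrightarrow> 0 \<le> b"
  using wnorm_leD[of s p b 0] by simp

lemma wnorm_le_mono: "wnorm_le s p a \<Longrightarrow> a \<le> b \<Longrightarrow> wnorm_le s p b"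
  by (meson order_trans wnorm_le_def)

lemma wnorm_le_radius_mono:
  assumes "0 \<le> r" "r \<le> s" "wnorm_le s p b"
  shows "wnorm_le r p b"
  unfolding wnorm_le_def
proof
  fix N
  have "(\<Sum>n<N. \<bar>p $ n\<bar> * r ^ n) \<le> (\<Sum>n<N. \<bar>p $ n\<bar> * s ^ n)"
    using assms by (intro sum_mono mult_left_mono power_mono) auto
  then show "(\<Sum>n<N. \<bar>p $ n\<bar> * r ^ n) \<le> b"
    using wnorm_leD[OF assms(3), of N] by simp
qed

lemma wnorm_le_add:
  assumes "0 \<le> s" "wnorm_le s p a" "wnorm_le s q b"
  shows "wnorm_le s (p + q) (a + b)"
  unfolding wnorm_le_def
proof
  fix N
  have "(\<Sum>n<N. \<bar>(p + q) $ n\<bar> * s ^ n) \<le> (\<Sum>n<N. \<bar>p $ n\<bar> * s ^ n + \<bar>q $ n\<bar> * s ^ n)"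
    using assms(1) by (intro sum_mono) (simp flip: distrib_right add: mult_right_mono abs_triangle_ineq)
  then show "(\<Sum>n<N. \<bar>(p + q) $ n\<bar> * s ^ n) \<le> a + b"
    using wnorm_leD[OF assms(2), of N] wnorm_leD[OF assms(3), of N] by (simp add: sum.distrib)
qed

lemma wnorm_le_uminus: "wnorm_le s p b \<Longrightarrow> wnorm_le s (- p) b"
  by (simp add: wnorm_le_def)

lemma wnorm_le_diff: "0 \<le> s \<Longrightarrow> wnorm_le s p a \<Longrightarrow> wnorm_le s q b \<Longrightarrow> wnorm_le s (p - q) (a + b)"
  using wnorm_le_add[of s p a "- q" b] wnorm_le_uminus[of s q b] by simp

lemma wnorm_le_X_power: "0 \<le> s \<Longrightarrow> wnorm_le s (fps_X ^ m) (s ^ m)"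
  unfolding wnorm_le_def by (auto simp: if_distrib[of "\<lambda>c. c * _"] sum.delta cong: if_cong)

lemma wnorm_le_const: "wnorm_le s (fps_const c) \<bar>c\<bar>"
  unfolding wnorm_le_def by (auto simp: if_distrib[of "\<lambda>c. \<bar>c\<bar> * _"] sum.delta cong: if_cong)

lemma wnorm_le_one: "wnorm_le s 1 1"
  using wnorm_le_const[of s 1] by simp

text \<open>
  The products \<open>p\<^sub>i q\<^sub>j\<close> with \<open>i + j < N\<close> are among those with \<open>i < N\<close> and \<open>j < N\<close>. So the norm is
  submultiplicative already on partial sums of equal length.
\<close>

lemma partial_wnorm_mult_le:
  fixes p q :: "real fps"
  assumes "0 \<le> s"
  shows "(\<Sum>n<N. \<bar>(p * q) $ n\<bar> * s ^ n)
    \<le> (\<Sum>n<N. \<bar>p $ n\<bar> * s ^ n) * (\<Sum>n<N. \<bar>q $ n\<bar> * s ^ n)"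
proof -
  let ?f = "\<lambda>i j. (\<bar>p $ i\<bar> * s ^ i) * (\<bar>q $ j\<bar> * s ^ j)"
  have "(\<Sum>n<N. \<bar>(p * q) $ n\<bar> * s ^ n) \<le> (\<Sum>n<N. \<Sum>i=0..n. ?f i (n - i))"
  proof (rule sum_mono)
    fix n
    have "\<bar>(p * q) $ n\<bar> * s ^ n \<le> (\<Sum>i=0..n. \<bar>p $ i * q $ (n - i)\<bar>) * s ^ n"
      unfolding fps_mult_nth using assms by (intro mult_right_mono sum_abs) auto
    also have "\<dots> = (\<Sum>i=0..n. ?f i (n - i))"
      unfolding sum_distrib_right
      by (intro sum.cong refl) (simp add: abs_mult mult_ac flip: power_add)
    finally show "\<bar>(p * q) $ n\<bar> * s ^ n \<le> (\<Sum>i=0..n. ?f i (n - i))" .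
  qed
  also have "\<dots> = (\<Sum>(n, i)\<in>(SIGMA n:{..<N}. {0..n}). ?f i (n - i))"
    by (simp add: sum.Sigma)
  also have "\<dots> = (\<Sum>(i, j)\<in>(\<lambda>(n, i). (i, n - i)) ` (SIGMA n:{..<N}. {0..n}). ?f i j)"
    by (subst sum.reindex) (auto simp: inj_on_def case_prod_unfold)
  also have "\<dots> \<le> (\<Sum>(i, j)\<in>{..<N} \<times> {..<N}. ?f i j)"
    using assms by (intro sum_mono2) auto
  also have "\<dots> = (\<Sum>n<N. \<bar>p $ n\<bar> * s ^ n) * (\<Sum>n<N. \<bar>q $ n\<bar> * s ^ n)"
    by (simp add: sum_product sum.cartesian_product)
  finally show ?thesis .
qed

lemma partial_wnorm_nonneg: "0 \<le> s \<Longrightarrow> 0 \<le> (\<Sum>n<N. \<bar>p $ n\<bar> * s ^ n)" for s :: real and p :: "real fps"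
  by (intro sum_nonneg) auto

lemma wnorm_le_mult:
  assumes "0 \<le> s" "wnorm_le s p a" "wnorm_le s q b"
  shows "wnorm_le s (p * q) (a * b)"
  unfolding wnorm_le_def
proof
  fix N
  show "(\<Sum>n<N. \<bar>(p * q) $ n\<bar> * s ^ n) \<le> a * b"
    by (rule order_trans[OF partial_wnorm_mult_le[OF assms(1)]])
      (intro mult_mono wnorm_leD assms partial_wnorm_nonneg wnorm_le_nonneg[OF assms(2)])
qed

lemma wnorm_le_nth_0: "wnorm_le s p b \<Longrightarrow> \<bar>p $ 0\<bar> \<le> b"
  using wnorm_leD[of s p b 1] by simp

text \<open>
  The Neumann series bound. The inverse \<open>p\<close> satisfies \<open>p = 1 + q p\<close>, so each of its partial norms
  \<open>W\<close> satisfies \<open>W \<le> 1 + a W\<close>; no infinite sum is formed.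
\<close>

lemma wnorm_le_inverse:
  assumes "0 \<le> s" "wnorm_le s q a" "a < 1"
  shows "wnorm_le s (inverse (1 - q)) (1 / (1 - a))"
  unfolding wnorm_le_def
proof
  fix N
  let ?p = "inverse (1 - q)" and ?W = "\<lambda>p. (\<Sum>n<N. \<bar>(p :: real fps) $ n\<bar> * s ^ n)"
  have "(1 - q) * ?p = 1"
    using wnorm_le_nth_0[OF assms(2)] assms(3) by (intro inverse_mult_eq_1') auto
  then have "?p = 1 + q * ?p"
    by (simp add: algebra_simps)
  then have "?W ?p = ?W (1 + q * ?p)" by simp
  also have "\<dots> \<le> ?W 1 + ?W (q * ?p)"
    unfolding sum.distrib[symmetric]
    using assms(1) by (intro sum_mono) (simp only: fps_add_nth flip: distrib_right,
      intro mult_right_mono abs_triangle_ineq zero_le_power)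
  also have "\<dots> \<le> 1 + a * ?W ?p"
    using wnorm_leD[OF wnorm_le_one] partial_wnorm_mult_le[OF assms(1), of q ?p N]
      mult_right_mono[OF wnorm_leD[OF assms(2), of N] partial_wnorm_nonneg[OF assms(1), of ?p N]]
    by (meson add_mono order_trans)
  finally have "?W ?p * (1 - a) \<le> 1" by (simp add: algebra_simps)
  then show "?W ?p \<le> 1 / (1 - a)"
    using assms(3) by (simp add: pos_le_divide_eq)
qed

lemma coeff_sums_exists:
  assumes "0 < s" "\<And>j. wnorm_le s (f j) (b j)" "b sums B"
  obtains F where "coeff_sums f F"
proof -
  have "summable (\<lambda>j. f j $ n)" for n
  proof (rule summable_comparison_test')
    show "summable (\<lambda>j. b j / s ^ n)"
      using assms(3) by (intro summable_divide) (rule sums_summable)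
    fix j
    have "\<bar>f j $ n\<bar> * s ^ n \<le> (\<Sum>i<Suc n. \<bar>f j $ i\<bar> * s ^ i)"
      using assms(1) by (intro member_le_sum) auto
    then show "norm (f j $ n) \<le> b j / s ^ n"
      using wnorm_leD[OF assms(2), of j "Suc n"] assms(1) by (simp add: field_simps)
  qed
  then have "coeff_sums f (Abs_fps (\<lambda>n. \<Sum>j. f j $ n))"
    by (auto simp: coeff_sums_def intro: summable_sums)
  then show ?thesis using that by blast
qed

text \<open>
  The triangle inequality for an infinite sum, by passing to the limit in each partial norm.
\<close>

lemma wnorm_le_coeff_sums:
  assumes "0 \<le> s" "coeff_sums f F" "\<And>j. wnorm_le s (f j) (b j)" "b sums B"
  shows "wnorm_le s F B"
  unfolding wnorm_le_def
proof
  fix N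
  have lim: "(\<lambda>M. \<Sum>n<N. \<bar>\<Sum>j<M. f j $ n\<bar> * s ^ n) \<longlonglongrightarrow> (\<Sum>n<N. \<bar>F $ n\<bar> * s ^ n)"
    using assms(2) unfolding coeff_sums_def sums_def by (intro tendsto_intros) auto
  have "(\<Sum>n<N. \<bar>\<Sum>j<M. f j $ n\<bar> * s ^ n) \<le> (\<Sum>j<M. b j)" for M
  proof -
    have "(\<Sum>n<N. \<bar>\<Sum>j<M. f j $ n\<bar> * s ^ n) \<le> (\<Sum>n<N. \<Sum>j<M. \<bar>f j $ n\<bar> * s ^ n)"
      unfolding sum_distrib_right[symmetric] using assms(1) by (intro sum_mono mult_right_mono sum_abs) auto
    also have "\<dots> = (\<Sum>j<M. \<Sum>n<N. \<bar>f j $ n\<bar> * s ^ n)"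
      by (rule sum.swap)
    also have "\<dots> \<le> (\<Sum>j<M. b j)"
      by (intro sum_mono wnorm_leD assms)
    finally show ?thesis .
  qed
  then show "(\<Sum>n<N. \<bar>F $ n\<bar> * s ^ n) \<le> B"
    by (intro LIMSEQ_le[OF lim assms(4)[unfolded sums_def]]) auto
qed

lemma wnorm_le_summable:
  assumes "0 \<le> s" "wnorm_le s p b"
  shows "summable (\<lambda>n. \<bar>p $ n\<bar> * s ^ n)" "(\<Sum>n. \<bar>p $ n\<bar> * s ^ n) \<le> b"
proof -
  show *: "summable (\<lambda>n. \<bar>p $ n\<bar> * s ^ n)"
    using assms by (intro bounded_imp_summable[of _ b]) (auto simp: lessThan_Suc_atMost[symmetric] simp del: sum.lessThan_Suc intro: wnorm_leD)
  show "(\<Sum>n. \<bar>p $ n\<bar> * s ^ n) \<le> b"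
    by (intro suminf_le_const * wnorm_leD assms)
qed

lemma wnorm_le_eval:
  assumes "0 \<le> s" "wnorm_le s p b"
  shows "summable (\<lambda>n. p $ n * s ^ n)" "\<bar>\<Sum>n. p $ n * s ^ n\<bar> \<le> b"
proof -
  have *: "summable (\<lambda>n. norm (p $ n * s ^ n))"
    using wnorm_le_summable(1)[OF assms] assms(1) by (simp add: abs_mult)
  show "summable (\<lambda>n. p $ n * s ^ n)"
    using summable_norm_cancel[OF *] .
  show "\<bar>\<Sum>n. p $ n * s ^ n\<bar> \<le> b"
    using summable_norm[OF *] wnorm_le_summable(2)[OF assms] assms(1) by (simp add: abs_mult)
qed

text \<open>
  Beyond index \<open>N\<close> each term at \<open>\<rho>\<close> is at most \<open>(\<rho> / s)\<^sup>N\<close> times the corresponding term of the norm at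
  \<open>s\<close>.
\<close>

lemma wnorm_le_tail:
  assumes "0 < \<rho>" "\<rho> \<le> s" "wnorm_le s p b"
  shows "\<bar>(\<Sum>n. p $ n * \<rho> ^ n) - (\<Sum>n<N. p $ n * \<rho> ^ n)\<bar> \<le> (\<rho> / s) ^ N * b"
proof -
  have s: "0 < s" using assms by simp
  have le: "\<bar>p $ n * \<rho> ^ n\<bar> \<le> (\<rho> / s) ^ N * (\<bar>p $ n\<bar> * s ^ n)" if "N \<le> n" for n
  proof -
    have "(\<rho> / s) ^ n \<le> (\<rho> / s) ^ N"
      using that assms s by (intro power_decreasing) auto
    then have "\<rho> ^ n \<le> (\<rho> / s) ^ N * s ^ n"
      using s by (simp add: power_divide field_simps)
    then show ?thesis
      using assms(1) by (simp add: abs_mult mult_left_mono mult.left_commute)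
  qed
  note sm = wnorm_le_summable[OF less_imp_le[OF s] assms(3)]
  have smn: "summable (\<lambda>n. norm (p $ n * \<rho> ^ n))"
    by (rule summable_comparison_test'[where N = 0, OF sm(1)])
      (use assms in \<open>auto simp: abs_mult intro!: mult_left_mono power_mono\<close>)
  have sm1: "summable (\<lambda>n. p $ n * \<rho> ^ n)"
    using summable_norm_cancel[OF smn] .
  have "(\<Sum>n. p $ n * \<rho> ^ n) - (\<Sum>n<N. p $ n * \<rho> ^ n) = (\<Sum>n. p $ (n + N) * \<rho> ^ (n + N))"
    using suminf_split_initial_segment[OF sm1, of N] by simp
  also have "\<bar>\<dots>\<bar> \<le> (\<Sum>n. (\<rho> / s) ^ N * (\<bar>p $ (n + N)\<bar> * s ^ (n + N)))"
  proof -
    have "\<bar>\<Sum>n. p $ (n + N) * \<rho> ^ (n + N)\<bar> \<le> (\<Sum>n. norm (p $ (n + N) * \<rho> ^ (n + N)))"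
      using summable_norm[of "\<lambda>n. p $ (n + N) * \<rho> ^ (n + N)"] summable_ignore_initial_segment[OF smn, of N]
      by simp
    also have "\<dots> \<le> (\<Sum>n. (\<rho> / s) ^ N * (\<bar>p $ (n + N)\<bar> * s ^ (n + N)))"
      using summable_ignore_initial_segment[OF smn, of N] summable_ignore_initial_segment[OF sm(1), of N]
      by (intro suminf_le summable_mult) (auto intro!: le)
    finally show ?thesis .
  qed
  also have "\<dots> = (\<rho> / s) ^ N * (\<Sum>n. \<bar>p $ (n + N)\<bar> * s ^ (n + N))"
    by (intro suminf_mult summable_ignore_initial_segment[OF sm(1)])
  also have "\<dots> \<le> (\<rho> / s) ^ N * b"
    using suminf_split_initial_segment[OF sm(1), of N] sm(2) partial_wnorm_nonneg[OF less_imp_le[OF s], where N=N and p=p] assms s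
    by (intro mult_left_mono) auto
  finally show ?thesis .
qed

section \<open>The dominant singularity\<close>

text \<open>
  What \<open>part_gf k j z\<close> lacks to \<open>z\<^sup>j\<close> when \<open>0 < z < 1\<close>; its sum over \<open>j\<close> measures how far
  \<open>rho k\<close> is from the root \<open>1/2\<close> of \<open>z / (1 - z) = 1\<close>.
\<close>

definition defect :: "nat \<Rightarrow> nat \<Rightarrow> real \<Rightarrow> real" where
  "defect k j z = z ^ (j * k) * (1 - z ^ j) / (1 - z ^ (j * k))"

lemma power_pos_less_one:
  fixes z :: real
  assumes "0 < z" "z < 1" "0 < m"
  shows "0 < z ^ m" "z ^ m < 1"
  using assms power_less_one_iff[of z m] by auto

lemma part_gf_eq_diff_defect:
  assumes "0 < z" "z < 1" "0 < j" "0 < k"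
  shows "part_gf k j z = z ^ j - defect k j z"
proof -
  have "z ^ (j * k) < 1"
    using power_pos_less_one(2)[OF assms(1,2)] assms by simp
  moreover have "z ^ (j * k) = z ^ j * z ^ (j * (k - 1))"
    using assms by (simp flip: power_add add: algebra_simps)
  ultimately show ?thesis
    unfolding part_gf_def defect_def by (simp add: field_simps)
qed

text \<open>
  With \<open>w = z\<^sup>j\<close>, the value \<open>part_gf k j z\<close> is \<open>1 - 1 / (1 + w + \<dots> + w\<^sup>k\<^sup>-\<^sup>1)\<close>, which increases
  with \<open>w\<close>.
\<close>

lemma part_gf_strict_mono:
  assumes "0 < y" "y < z" "z < 1" "0 < j" "1 < k"
  shows "part_gf k j y < part_gf k j z"
proof -
  have eq: "part_gf k j v = 1 - 1 / (\<Sum>i<k. (v ^ j) ^ i)" if v: "0 < v" "v < 1" for v :: real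
  proof -
    have w: "0 < v ^ j" "v ^ j < 1"
      using power_pos_less_one[OF v assms(4)] by auto
    have wk: "(v ^ j) ^ k < 1"
      using power_pos_less_one[OF w, of k] assms by simp
    have "part_gf k j v = 1 - (1 - v ^ j) / (1 - (v ^ j) ^ k)"
      unfolding part_gf_eq_diff_defect[OF v assms(4) order.strict_trans[OF zero_less_one assms(5)]]
        defect_def power_mult
      using wk by (simp add: field_simps)
    then show ?thesis
      using w by (simp add: one_diff_power_eq[of "v ^ j" k])
  qed
  have "y ^ j < z ^ j"
    using assms by (intro power_strict_mono) auto
  then have "(\<Sum>i<k. (y ^ j) ^ i) < (\<Sum>i<k. (z ^ j) ^ i)"
    using assms by (intro sum_strict_mono_ex1) (auto intro!: power_mono bexI[of _ 1])
  moreover have "0 < (\<Sum>i<k. (y ^ j) ^ i)"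
    using assms by (intro sum_pos) auto
  ultimately show ?thesis
    using assms by (simp add: eq frac_less2)
qed

lemma defect_bounds:
  assumes "0 < z" "z < 1" "0 < k"
  shows "0 \<le> defect k (Suc j) z" "defect k (Suc j) z \<le> (z ^ k) ^ Suc j / (1 - z ^ k)"
proof -
  let ?x = "z ^ k"
  have x: "0 < ?x" "?x < 1"
    using power_pos_less_one[OF assms] by auto
  have zj: "0 < z ^ Suc j" "z ^ Suc j < 1"
    using power_pos_less_one[OF assms(1,2) zero_less_Suc] by auto
  have xj: "0 < ?x ^ Suc j" "?x ^ Suc j \<le> ?x"
    using x power_decreasing[of 1 "Suc j" ?x] by auto
  have eq: "defect k (Suc j) z = ?x ^ Suc j * (1 - z ^ Suc j) / (1 - ?x ^ Suc j)"
    unfolding defect_def by (simp only: mult.commute[of "Suc j" k] power_mult)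
  show "0 \<le> defect k (Suc j) z"
    unfolding eq using x zj xj by (intro divide_nonneg_nonneg mult_nonneg_nonneg) linarith+
  have "?x ^ Suc j * (1 - z ^ Suc j) / (1 - ?x ^ Suc j) \<le> (?x ^ Suc j * 1) / (1 - ?x)"
    using x zj xj by (intro frac_le mult_left_mono) linarith+
  then show "defect k (Suc j) z \<le> ?x ^ Suc j / (1 - ?x)"
    unfolding eq by simp
qed

lemma geometric_Suc_sums: "0 < z \<Longrightarrow> z < 1 \<Longrightarrow> (\<lambda>j. z ^ Suc j) sums (z / (1 - z))" for z :: real
  using sums_mult[OF geometric_sums[of z], of z] by simp

lemma defect_sums:
  assumes "0 < z" "z < 1" "0 < k"
  obtains D where "(\<lambda>j. defect k (Suc j) z) sums D" "0 \<le> D" "D \<le> z ^ k / (1 - z ^ k)\<^sup>2"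
proof -
  note x = power_pos_less_one[OF assms]
  note b = defect_bounds[OF assms]
  have maj: "(\<lambda>j. (z ^ k) ^ Suc j / (1 - z ^ k)) sums (z ^ k / (1 - z ^ k) / (1 - z ^ k))"
    by (intro sums_divide geometric_Suc_sums x)
  have sm: "summable (\<lambda>j. defect k (Suc j) z)"
    by (rule summable_comparison_test'[OF sums_summable[OF maj], of 0])
      (use b in \<open>simp del: power_Suc\<close>)
  show ?thesis
  proof
    show *: "(\<lambda>j. defect k (Suc j) z) sums (\<Sum>j. defect k (Suc j) z)"
      using sm by (rule summable_sums)
    show "0 \<le> (\<Sum>j. defect k (Suc j) z)"
      by (intro suminf_nonneg sm b)
    show "(\<Sum>j. defect k (Suc j) z) \<le> z ^ k / (1 - z ^ k)\<^sup>2"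
      using sums_le[OF b(2) * maj] by (simp add: power2_eq_square)
  qed
qed

lemma part_gf_sums:
  assumes "0 < z" "z < 1" "0 < k" "(\<lambda>j. defect k (Suc j) z) sums D"
  shows "(\<lambda>j. part_gf k (Suc j) z) sums (z / (1 - z) - D)"
  using sums_diff[OF geometric_Suc_sums[OF assms(1,2)] assms(4)] assms(1-3)
  by (simp add: part_gf_eq_diff_defect del: power_Suc)

text \<open>
  The terms lie between \<open>- b\<^sup>j\<close> and \<open>b\<^sup>j\<close> on the interval, so the M-test applies.
\<close>

lemma continuous_on_part_gf_suminf:
  assumes "0 < a" "b < 1" "0 < k"
  shows "continuous_on {a..b} (\<lambda>z. \<Sum>j. part_gf k (Suc j) z)"
proof (cases "a \<le> b")
  case True
  show ?thesis
  proof (rule uniform_limit_theorem)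
    show "uniform_limit {a..b} (\<lambda>n z. \<Sum>j<n. part_gf k (Suc j) z) (\<lambda>z. \<Sum>j. part_gf k (Suc j) z) sequentially"
    proof (rule Weierstrass_m_test)
      show "summable (\<lambda>j. b ^ Suc j)"
        using geometric_Suc_sums[of b] assms True sums_summable by force
      fix j z assume z: "z \<in> {a..b}"
      then have z01: "0 < z" "z < 1" using assms by auto
      have "z ^ (Suc j * k) \<le> z ^ Suc j"
        using z01 mult_le_mono2[of 1 k "Suc j"] assms by (intro power_decreasing) auto
      moreover have "defect k (Suc j) z \<le> z ^ Suc j"
      proof -
        have w: "z ^ (Suc j * k) < 1"
          using power_pos_less_one(2)[OF z01] assms by simp
        have "z ^ (Suc j * k) * (1 - z ^ Suc j) \<le> z ^ Suc j * (1 - z ^ (Suc j * k))"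
          using \<open>z ^ (Suc j * k) \<le> z ^ Suc j\<close>
          unfolding right_diff_distrib mult_1_right mult.commute[of "z ^ Suc j"] by (rule diff_right_mono)
        then show ?thesis
          unfolding defect_def using w by (simp add: pos_divide_le_eq del: power_Suc)
      qed
      moreover have "0 \<le> defect k (Suc j) z"
        by (rule defect_bounds[OF z01 assms(3)])
      moreover have "z ^ Suc j \<le> b ^ Suc j"
        using z z01 by (intro power_mono) auto
      ultimately show "norm (part_gf k (Suc j) z) \<le> b ^ Suc j"
        unfolding part_gf_eq_diff_defect[OF z01 zero_less_Suc assms(3)] real_norm_def abs_le_iff
        by linarith
    qed
    have "z ^ (Suc j * k) \<noteq> 1" if "z \<in> {a..b}" for z j
      using power_pos_less_one(2)[of z "Suc j * k"] that assms by auto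
    then show "\<forall>\<^sub>F n in sequentially. continuous_on {a..b} (\<lambda>z. \<Sum>j<n. part_gf k (Suc j) z)"
      unfolding part_gf_def
      by (intro always_eventually allI continuous_intros) auto
  qed simp
qed simp

text \<open>
  These two bounds decide how large every later sum can be. The worst case is \<open>k = 4\<close>, where \<open>(3/5)\<^sup>4 = 81/625\<close>; for larger
  \<open>k\<close> both quantities only decrease.
\<close>

lemma three_fifths_power_bounds:
  assumes "4 \<le> k"
  shows "(3 / 5 :: real) ^ k \<le> 81 / 625" "real k * (3 / 5) ^ k \<le> 324 / 625"
proof -
  show "(3 / 5 :: real) ^ k \<le> 81 / 625"
    using power_decreasing[OF assms, of "3 / 5 :: real"] by (simp add: power_divide)
  show "real k * (3 / 5) ^ k \<le> 324 / 625"
    using assms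
  proof (induction k rule: dec_induct)
    case base
    show ?case by (simp add: power_divide)
  next
    case (step k)
    have "real (Suc k) * (3 / 5) \<le> real k"
      using step(1) by simp
    then have "real (Suc k) * (3 / 5) * (3 / 5) ^ k \<le> real k * (3 / 5) ^ k"
      by (intro mult_right_mono) auto
    also have "\<dots> \<le> 324 / 625" by (rule step(3))
    finally show ?case by (simp only: power_Suc mult.assoc)
  qed
qed

text \<open>
  These factors arise from summing \<open>x\<^sup>j\<close> and \<open>j x\<^sup>j\<close> over \<open>j \<ge> 1\<close> after the denominators \<open>1 - x\<^sup>j\<close> have
  been estimated by \<open>1 - x\<close>.
\<close>

lemma geometric_sum_factor_bounds:
  fixes x :: real
  assumes "0 \<le> x" "x \<le> 81 / 625"
  shows "x / (1 - x)\<^sup>2 \<le> 4 / 3 * x" "x / (1 - x) ^ 4 \<le> 7 / 4 * x"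
proof -
  have m: "(544 / 625) ^ n \<le> (1 - x) ^ n" for n
    using assms by (intro power_mono) auto
  have "x / (1 - x)\<^sup>2 \<le> x / (3 / 4)"
    using m[of 2] assms by (intro divide_left_mono) (auto simp: power_divide)
  then show "x / (1 - x)\<^sup>2 \<le> 4 / 3 * x" by simp
  have "x / (1 - x) ^ 4 \<le> x / (4 / 7)"
    using m[of 4] assms by (intro divide_left_mono) (auto simp: power_divide)
  then show "x / (1 - x) ^ 4 \<le> 7 / 4 * x" by simp
qed

text \<open>
  The geometric series \<open>z / (1 - z)\<close> is \<open>1\<close> at \<open>1/2\<close> and \<open>3/2\<close> at \<open>3/5\<close>, while the defects sum to a
  nonnegative number that is at most \<open>1/2\<close> at \<open>3/5\<close>. The intermediate value theorem gives a solution, and strict monotonicity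
  of every term makes it the least one.
\<close>

lemma rho_characterization:
  assumes "4 \<le> k"
  shows "1 / 2 \<le> rho k" "rho k \<le> 3 / 5" "(\<lambda>j. part_gf k (Suc j) (rho k)) sums 1"
proof -
  have k: "0 < k" "1 < k" using assms by auto
  let ?S = "\<lambda>z. \<Sum>j. part_gf k (Suc j) z"
  have "?S (1 / 2) \<le> 1"
  proof -
    obtain D where D: "(\<lambda>j. defect k (Suc j) (1 / 2)) sums D" "0 \<le> D"
      using defect_sums[of "1 / 2" k] k by auto
    show ?thesis
      using part_gf_sums[OF _ _ k(1) D(1)] D(2) by (simp add: sums_iff)
  qed
  moreover have "1 \<le> ?S (3 / 5)"
  proof -
    obtain D where D: "(\<lambda>j. defect k (Suc j) (3 / 5)) sums D" "D \<le> (3 / 5) ^ k / (1 - (3 / 5) ^ k)\<^sup>2"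
      using defect_sums[of "3 / 5" k] k by auto
    have "D \<le> 1 / 2"
      using D(2) geometric_sum_factor_bounds(1)[of "(3 / 5) ^ k"] three_fifths_power_bounds(1)[OF assms] by simp
    then show ?thesis
      using part_gf_sums[OF _ _ k(1) D(1)] by (simp add: sums_iff)
  qed
  ultimately obtain z where z: "1 / 2 \<le> z" "z \<le> 3 / 5" "?S z = 1"
    using IVT'[of ?S "1 / 2" 1 "3 / 5"] continuous_on_part_gf_suminf[of "1 / 2" "3 / 5" k] k by auto
  have sums: "(\<lambda>j. part_gf k (Suc j) z) sums 1"
  proof -
    obtain D where "(\<lambda>j. defect k (Suc j) z) sums D"
      using defect_sums[of z k] k z by auto
    then show ?thesis
      using part_gf_sums[of z k D] k z by (auto simp: sums_iff)
  qed
  have "rho k = z"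
    unfolding rho_def
  proof (rule Least_equality)
    fix y assume y: "0 < y \<and> (\<lambda>j. part_gf k (Suc j) y) sums 1"
    show "z \<le> y"
    proof (rule ccontr)
      assume "\<not> z \<le> y"
      then have pos: "0 < part_gf k (Suc j) z - part_gf k (Suc j) y" for j
        using part_gf_strict_mono[of y z "Suc j" k] y z k by simp
      have "(\<lambda>j. part_gf k (Suc j) z - part_gf k (Suc j) y) sums (1 - 1)"
        using sums y by (intro sums_diff) auto
      then show False
        using suminf_pos[of "\<lambda>j. part_gf k (Suc j) z - part_gf k (Suc j) y"] pos
        by (simp add: sums_iff)
    qed
  qed (use z sums in auto)
  then show "1 / 2 \<le> rho k" "rho k \<le> 3 / 5" "(\<lambda>j. part_gf k (Suc j) (rho k)) sums 1"
    using z sums by auto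
qed

text \<open>
  This is the equation defining \<open>rho k\<close>, solved for the defects: \<open>r / (1 - r) - D = 1\<close> says
  \<open>(1 - r) D = 2 r - 1\<close>.
\<close>

lemma defect_rho_sums:
  assumes "4 \<le> k"
  shows "(\<lambda>j. (1 - rho k) * defect k (Suc j) (rho k)) sums (2 * rho k - 1)"
    and "2 * rho k - 1 \<le> rho k ^ k"
proof -
  note r = rho_characterization[OF assms]
  obtain D where D: "(\<lambda>j. defect k (Suc j) (rho k)) sums D" "D \<le> rho k ^ k / (1 - rho k ^ k)\<^sup>2"
    and D0: "0 \<le> D"
    using defect_sums[of "rho k" k] r assms by auto
  have "rho k / (1 - rho k) - D = 1"
    using part_gf_sums[OF _ _ _ D(1)] r sums_unique2 assms by force
  then have eq: "(1 - rho k) * D = 2 * rho k - 1"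
    using r by (simp add: field_simps)
  show "(\<lambda>j. (1 - rho k) * defect k (Suc j) (rho k)) sums (2 * rho k - 1)"
    using sums_mult[OF D(1), of "1 - rho k"] unfolding eq .
  have "rho k ^ k \<le> (3 / 5) ^ k"
    using r by (intro power_mono) auto
  then have "rho k ^ k / (1 - rho k ^ k)\<^sup>2 \<le> 4 / 3 * rho k ^ k"
    using three_fifths_power_bounds(1)[OF assms] r(1) by (intro geometric_sum_factor_bounds) auto
  moreover have "0 \<le> rho k ^ k" using r by simp
  ultimately have "D \<le> 2 * rho k ^ k"
    using D(2) by linarith
  then have "(1 - rho k) * D \<le> 1 / 2 * (2 * rho k ^ k)"
    using r D0 by (intro mult_mono) auto
  then show "2 * rho k - 1 \<le> rho k ^ k"
    unfolding eq by simp
qed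

text \<open>
  The root exceeds \<open>1/2\<close> by so little that \<open>(2 r)\<^sup>k \<le> exp (k (2 r - 1))\<close> stays bounded: the exponent is
  at most \<open>k r\<^sup>k \<le> k (3/5)\<^sup>k\<close>.
\<close>

lemma rho_power_le:
  assumes "4 \<le> k"
  shows "rho k ^ k \<le> 3 / 2 ^ k"
proof -
  note r = rho_characterization[OF assms]
  have "rho k ^ k \<le> (3 / 5) ^ k"
    using r by (intro power_mono) auto
  then have "real k * (2 * rho k - 1) \<le> real k * (3 / 5) ^ k"
    using defect_rho_sums(2)[OF assms] by (intro mult_left_mono) auto
  then have le: "real k * (2 * rho k - 1) \<le> 1"
    using three_fifths_power_bounds(2)[OF assms] by simp
  have "(2 * rho k) ^ k \<le> exp (2 * rho k - 1) ^ k"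
    using r exp_ge_add_one_self[of "2 * rho k - 1"] by (intro power_mono) auto
  also have "\<dots> = exp (real k * (2 * rho k - 1))"
    by (simp flip: exp_of_nat_mult)
  also have "\<dots> \<le> 3"
    using le exp_le by (meson exp_le_cancel_iff order_trans)
  finally show ?thesis
    by (simp add: power_mult_distrib field_simps)
qed

section \<open>Divided differences of the defects\<close>

text \<open>
  The divided difference \<open>(X\<^sup>m - r\<^sup>m) / (X - r)\<close>, in Horner form so that the bound below follows by
  induction.
\<close>

primrec power_quot :: "real \<Rightarrow> nat \<Rightarrow> real fps" where
  "power_quot r 0 = 0"
| "power_quot r (Suc m) = fps_X * power_quot r m + fps_const (r ^ m)"

lemma power_quot: "fps_X ^ m - fps_const (r ^ m) = (fps_X - fps_const r) * power_quot r m"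
proof (induction m)
  case 0
  then show ?case by (simp flip: fps_const_1_eq_1)
next
  case (Suc m)
  have "fps_X ^ Suc m - fps_const (r ^ Suc m)
      = fps_X * (fps_X ^ m - fps_const (r ^ m)) + fps_const (r ^ m) * (fps_X - fps_const r)"
    by (simp add: algebra_simps flip: fps_const_mult)
  also have "\<dots> = (fps_X - fps_const r) * power_quot r (Suc m)"
    unfolding Suc by (simp add: algebra_simps)
  finally show ?case .
qed

text \<open>
  The quotient has \<open>m\<close> coefficients, and \<open>r \<le> s\<close> makes each contribute at most \<open>s\<^sup>m\<^sup>-\<^sup>1\<close>.
\<close>

lemma wnorm_le_power_quot:
  assumes "0 \<le> r" "r \<le> s"
  shows "wnorm_le s (power_quot r m) (real m * s ^ (m - 1))"
proof (induction m)
  case 0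
  then show ?case by (simp add: wnorm_le_def)
next
  case (Suc m)
  have "wnorm_le s (fps_X ^ 1 * power_quot r m + fps_const (r ^ m)) (s ^ 1 * (real m * s ^ (m - 1)) + \<bar>r ^ m\<bar>)"
    using assms by (intro wnorm_le_add wnorm_le_mult wnorm_le_X_power wnorm_le_const Suc) auto
  moreover have "s ^ 1 * (real m * s ^ (m - 1)) + \<bar>r ^ m\<bar> \<le> real (Suc m) * s ^ m"
    using power_mono[OF assms(2,1), of m] assms by (cases m) (auto simp: algebra_simps)
  ultimately show ?case
    by (auto intro: wnorm_le_mono)
qed

text \<open>
  The power series of \<open>defect k j\<close>, multiplied by \<open>1 - X\<close>; the factor turns the geometric series
  \<open>X / (1 - X)\<close> into the polynomial \<open>X\<close>.
\<close>

definition part_defect :: "nat \<Rightarrow> nat \<Rightarrow> real fps" where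
  "part_defect k j = (1 - fps_X) * (1 - fps_X ^ j) * (fps_X ^ (j * k) * inverse (1 - fps_X ^ (j * k)))"

text \<open>
  The divided difference of \<open>part_defect k j\<close> at \<open>r\<close>, split by the product rule into one part for
  \<open>(1 - X) (1 - X\<^sup>j)\<close> and one for \<open>Y / (1 - Y)\<close> with \<open>Y = X\<^sup>j\<^sup>k\<close>. The second part carries the small
  factor \<open>(1 - r) (1 - r\<^sup>j)\<close>; this gain is what makes the bounds good enough for \<open>k = 4\<close>.
\<close>

definition part_defect_quot :: "nat \<Rightarrow> real \<Rightarrow> nat \<Rightarrow> real fps" where
  "part_defect_quot k r j =
     - ((1 - fps_X) * power_quot r j + fps_const (1 - r ^ j))
         * (fps_X ^ (j * k) * inverse (1 - fps_X ^ (j * k)))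
     + fps_const ((1 - r) * (1 - r ^ j) / (1 - r ^ (j * k)))
         * (power_quot r (j * k) * inverse (1 - fps_X ^ (j * k)))"

lemma one_minus_X_power_mult_inverse:
  assumes "0 < m"
  shows "(1 - fps_X ^ m) * inverse (1 - fps_X ^ m) = (1 :: real fps)"
  using assms by (intro inverse_mult_eq_1') (simp add: fps_X_power_nth)

text \<open>
  The product rule for divided differences, where \<open>I\<close> is \<open>1 / (1 - Y)\<close>, \<open>c\<close> is its value \<open>1 / (1 - w)\<close>,
  and \<open>Y I - w c = c (Y - w) I\<close>.
\<close>

lemma factor_difference:
  fixes X r P p Q Y w I c Q' :: "'a :: comm_ring_1"
  assumes "P - p = (X - r) * Q" "Y - w = (X - r) * Q'" "(1 - Y) * I = 1" "c * (1 - w) = 1"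
  shows "(1 - X) * (1 - P) * (Y * I) = (1 - r) * (1 - p) * (w * c)
    + (X - r) * (- ((1 - X) * Q + (1 - p)) * (Y * I) + (1 - r) * (1 - p) * c * (Q' * I))"
proof -
  have 1: "Y * I - w * c = (X - r) * (c * (Q' * I))"
  proof -
    have I: "I = 1 + Y * I" and c: "c = 1 + w * c"
      using assms(3,4) by (simp_all add: algebra_simps)
    have "Y * I - w * c = (1 + w * c) * (Y * I) - w * c * (1 + Y * I)"
      by (simp add: algebra_simps)
    also have "\<dots> = c * ((Y - w) * I)"
      unfolding I[symmetric] c[symmetric] by (simp add: algebra_simps)
    finally show ?thesis
      unfolding assms(2) by (simp add: mult_ac)
  qed
  have 2: "(1 - X) * (1 - P) - (1 - r) * (1 - p) = (X - r) * - ((1 - X) * Q + (1 - p))"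
  proof -
    have P: "P = p + (X - r) * Q"
      using assms(1) by (simp add: algebra_simps)
    show ?thesis
      unfolding P by (simp add: algebra_simps)
  qed
  have "(1 - X) * (1 - P) * (Y * I) - (1 - r) * (1 - p) * (w * c)
    = ((1 - X) * (1 - P) - (1 - r) * (1 - p)) * (Y * I) + (1 - r) * (1 - p) * (Y * I - w * c)"
    by (simp add: algebra_simps)
  then show ?thesis
    unfolding 1 2 by (simp add: algebra_simps)
qed

lemma part_defect_quot:
  assumes "0 < r" "r < 1" "0 < j" "0 < k"
  shows "part_defect k j = fps_const ((1 - r) * defect k j r) + (fps_X - fps_const r) * part_defect_quot k r j"
proof -
  have w: "r ^ (j * k) < 1"
    using power_pos_less_one(2)[OF assms(1,2)] assms by simp
  define w c where "w = r ^ (j * k)" and "c = 1 / (1 - w)"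
  have c: "fps_const c * (1 - fps_const w) = 1"
    unfolding c_def using w by (simp add: w_def flip: fps_const_1_eq_1)
  have const: "fps_const (1 - v) = 1 - fps_const v" for v :: real
    by (simp flip: fps_const_1_eq_1)
  have ac: "(1 - r) * (1 - r ^ j) / (1 - w) = (1 - r) * (1 - r ^ j) * c"
    "(1 - r) * defect k j r = (1 - r) * (1 - r ^ j) * (w * c)"
    by (simp_all add: c_def w_def defect_def)
  show ?thesis
    unfolding part_defect_def part_defect_quot_def w_def[symmetric] ac
    unfolding fps_const_mult[symmetric] const
    by (intro factor_difference power_quot one_minus_X_power_mult_inverse c power_quot[of "j * k" r, folded w_def])
      (use assms in auto)
qed

lemma mult_power_pred_le:
  assumes "0 < s" "s \<le> 3 / 5" "0 < j"
  shows "real j * s ^ (j - 1) \<le> 5 / 4"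
proof -
  have "real (Suc (Suc i)) * (3 / 5) ^ Suc i \<le> 5 / 4" for i
  proof (induction i)
    case (Suc i)
    have "real (Suc (Suc (Suc i))) * (3 / 5) \<le> real (Suc (Suc i))" by simp
    then have "real (Suc (Suc (Suc i))) * (3 / 5) * (3 / 5) ^ Suc i \<le> real (Suc (Suc i)) * (3 / 5) ^ Suc i"
      by (intro mult_right_mono) auto
    also have "\<dots> \<le> 5 / 4" by (rule Suc)
    finally show ?case by (simp only: power_Suc mult.assoc)
  qed simp
  then have "real (Suc i) * (3 / 5) ^ i \<le> 5 / 4" for i
    by (cases i) auto
  moreover have "real j * s ^ (j - 1) \<le> real (Suc (j - 1)) * (3 / 5) ^ (j - 1)"
    using assms by (intro mult_mono power_mono) auto
  ultimately show ?thesis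
    by (meson order_trans)
qed

section \<open>Splitting off the pole\<close>

text \<open>
  A bound for the norm of \<open>part_defect_quot k r j\<close> when \<open>1/2 \<le> r \<le> s \<le> 3/5\<close>. Its two terms
  belong to the two terms of that divided difference, and with \<open>x = s\<^sup>k\<close> they are multiples of \<open>x\<^sup>j\<close> and \<open>j x\<^sup>j\<close>, so that
  the sum over \<open>j\<close> is explicit.
\<close>

definition quot_bound :: "nat \<Rightarrow> real \<Rightarrow> nat \<Rightarrow> real" where
  "quot_bound k s j = 3 * ((s ^ k) ^ j / (1 - s ^ k)) + real k / (2 * s) * (real j * (s ^ k) ^ j / (1 - s ^ k)\<^sup>2)"

lemma wnorm_le_part_defect_quot:
  assumes "1 / 2 \<le> r" "r \<le> s" "s \<le> 3 / 5" "0 < k" "0 < j"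
  shows "wnorm_le s (part_defect_quot k r j) (quot_bound k s j)"
proof -
  define x y where "x = s ^ k" and "y = s ^ (j * k)"
  have s: "0 < s" "s < 1" using assms by auto
  have x: "0 < x" "x < 1"
    unfolding x_def using power_pos_less_one[OF s] assms by auto
  have y: "y = x ^ j"
    unfolding x_def y_def by (simp only: mult.commute[of j k] power_mult)
  have y01: "0 < y" "y \<le> x"
    using x power_decreasing[of 1 j x] assms(5) unfolding y by auto
  have rj: "0 < r ^ j" "r ^ j < 1"
    using power_pos_less_one[of r j] assms by auto
  have ry: "r ^ (j * k) \<le> y"
    unfolding y_def using assms by (intro power_mono) auto
  have inv: "wnorm_le s (inverse (1 - fps_X ^ (j * k))) (1 / (1 - y))"
    unfolding y_def using s y01 x by (intro wnorm_le_inverse wnorm_le_X_power) (auto simp: y_def)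
  \<comment> \<open>The constant \<open>3\<close> in the bound for \<open>b1\<close> is \<open>8/5 * 5/4 + 1\<close>.\<close>
  define b1 where "b1 = ((1 + s ^ 1) * (real j * s ^ (j - 1)) + \<bar>1 - r ^ j\<bar>) * (y * (1 / (1 - y)))"
  define b2 where "b2 = \<bar>(1 - r) * (1 - r ^ j) / (1 - r ^ (j * k))\<bar>
      * ((real (j * k) * s ^ (j * k - 1)) * (1 / (1 - y)))"
  have "wnorm_le s (- ((1 - fps_X ^ 1) * power_quot r j + fps_const (1 - r ^ j))
         * (fps_X ^ (j * k) * inverse (1 - fps_X ^ (j * k)))
     + fps_const ((1 - r) * (1 - r ^ j) / (1 - r ^ (j * k)))
         * (power_quot r (j * k) * inverse (1 - fps_X ^ (j * k)))) (b1 + b2)"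
    unfolding b1_def b2_def
    using s assms wnorm_le_X_power[of s "j * k", folded y_def]
    by (intro wnorm_le_add wnorm_le_mult wnorm_le_uminus wnorm_le_diff wnorm_le_one wnorm_le_X_power wnorm_le_const
        wnorm_le_power_quot inv) auto
  moreover have "b1 \<le> 3 * (x ^ j / (1 - x))"
    unfolding b1_def
  proof (rule mult_mono)
    have "(1 + s ^ 1) * (real j * s ^ (j - 1)) \<le> 8 / 5 * (5 / 4)"
      using s assms by (intro mult_mono mult_power_pred_le) auto
    then show "(1 + s ^ 1) * (real j * s ^ (j - 1)) + \<bar>1 - r ^ j\<bar> \<le> 3"
      using rj by simp
    show "y * (1 / (1 - y)) \<le> x ^ j / (1 - x)"
      unfolding y[symmetric] using y01 x by (simp add: frac_le)
  qed (use y01 x in auto)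
  moreover have "b2 \<le> real k / (2 * s) * (real j * x ^ j / (1 - x)\<^sup>2)"
  proof -
    \<comment> \<open>The factor \<open>1 - r \<le> 1/2\<close> provides the \<open>2\<close> in \<open>real k / (2 * s)\<close>.\<close>
    have "\<bar>(1 - r) * (1 - r ^ j) / (1 - r ^ (j * k))\<bar> = (1 - r) * (1 - r ^ j) / (1 - r ^ (j * k))"
      using rj ry y01 x assms by (intro abs_of_nonneg divide_nonneg_nonneg mult_nonneg_nonneg) auto
    also have "\<dots> \<le> (1 / 2 * 1) / (1 - x)"
      using rj ry y01 x assms by (intro frac_le mult_mono) auto
    finally have c: "\<bar>(1 - r) * (1 - r ^ j) / (1 - r ^ (j * k))\<bar> \<le> 1 / 2 / (1 - x)" by simp
    have "s ^ (j * k - 1) = y / s"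
      unfolding y_def using s assms by (simp add: power_diff)
    then have "real (j * k) * s ^ (j * k - 1) * (1 / (1 - y)) = real (j * k) * (y / s) * (1 / (1 - y))" by simp
    also have "\<dots> \<le> real (j * k) * (y / s) * (1 / (1 - x))"
      using y01 x s by (intro mult_left_mono frac_le) auto
    finally have d: "real (j * k) * s ^ (j * k - 1) * (1 / (1 - y)) \<le> real (j * k) * (y / s) * (1 / (1 - x))" .
    have "b2 \<le> (1 / 2 / (1 - x)) * (real (j * k) * (y / s) * (1 / (1 - x)))"
      unfolding b2_def by (rule mult_mono[OF c d]) (use s y01 x in auto)
    also have "\<dots> = real k / (2 * s) * (real j * x ^ j / (1 - x)\<^sup>2)"
      unfolding y of_nat_mult using s x by (simp add: field_simps power2_eq_square)
    finally show ?thesis .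
  qed
  ultimately show ?thesis
    unfolding part_defect_quot_def quot_bound_def x_def[symmetric] by (auto intro: wnorm_le_mono)
qed

lemma quot_bound_sums:
  assumes "0 < s" "s \<le> 3 / 5" "4 \<le> k"
  obtains B where "(\<lambda>j. quot_bound k s (Suc j)) sums B" "B \<le> 4 * s ^ k + 7 / 8 * (real k * s ^ k) / s"
proof
  define x where "x = s ^ k"
  have "s ^ k \<le> (3 / 5) ^ k"
    using assms by (intro power_mono) auto
  then have x: "0 < x" "x \<le> 81 / 625"
    using three_fifths_power_bounds(1)[OF assms(3)] assms(1) unfolding x_def by auto
  have g: "(\<lambda>j. x ^ Suc j) sums (x / (1 - x))"
    using geometric_Suc_sums x by simp
  have "(\<lambda>j. x * (of_nat (Suc j) * x ^ j)) sums (x * (1 / (1 - x)\<^sup>2))"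
    using x by (intro sums_mult geometric_deriv_sums) auto
  then have d: "(\<lambda>j. real (Suc j) * x ^ Suc j) sums (x / (1 - x)\<^sup>2)"
    by (simp add: mult_ac)
  show "(\<lambda>j. quot_bound k s (Suc j)) sums
      (3 * (x / (1 - x) / (1 - x)) + real k / (2 * s) * (x / (1 - x)\<^sup>2 / (1 - x)\<^sup>2))"
    unfolding quot_bound_def x_def[symmetric]
    by (intro sums_add sums_mult sums_divide g d)
  have "3 * (x / (1 - x)\<^sup>2) + real k / (2 * s) * (x / (1 - x) ^ 4) \<le> 3 * (4 / 3 * x) + real k / (2 * s) * (7 / 4 * x)"
    using geometric_sum_factor_bounds[of x] x assms by (intro add_mono mult_left_mono) auto
  then show "3 * (x / (1 - x) / (1 - x)) + real k / (2 * s) * (x / (1 - x)\<^sup>2 / (1 - x)\<^sup>2)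
      \<le> 4 * s ^ k + 7 / 8 * (real k * s ^ k) / s"
    unfolding x_def[symmetric] by (simp add: power2_eq_square power4_eq_xxxx mult_ac)
qed

text \<open>
  By \<open>gf_from_relation\<close>, the product of \<open>part_defect k j\<close> and the generating function is \<open>1 - X\<close> times
  the difference between putting an arbitrary part \<open>j\<close> in front and doing so without creating a run. Summing over \<open>j\<close> telescopes
  on one side and exhausts all nonempty compositions on the other.
\<close>

lemma coeff_sums_part_defect:
  assumes "0 < k"
  shows "coeff_sums (\<lambda>j. part_defect k (Suc j) * gf k) ((2 * fps_X - 1) * gf k + (1 - fps_X))"
proof -
  have "part_defect k (Suc j) * gf k
      = fps_X ^ Suc j * (1 - fps_X) * gf k - gf_from k (Suc j) * (1 - fps_X)" for j
  proof -
    define Y I where "Y = (fps_X ^ (Suc j * k) :: real fps)" and "I = inverse (1 - Y)"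
    have I: "(1 - Y) * I = 1"
      unfolding I_def Y_def using assms by (intro one_minus_X_power_mult_inverse) simp
    have rel: "(1 - Y) * gf_from k (Suc j) = (fps_X ^ Suc j - Y) * gf k"
      unfolding Y_def by (rule gf_from_relation) (use assms in auto)
    have YI: "Y * I = I - 1"
      using I by (simp add: algebra_simps)
    have "gf_from k (Suc j) = ((1 - Y) * I) * gf_from k (Suc j)"
      unfolding I by simp
    also have "\<dots> = I * ((fps_X ^ Suc j - Y) * gf k)"
      unfolding rel[symmetric] by (simp add: mult_ac)
    also have "\<dots> = (fps_X ^ Suc j * I - Y * I) * gf k"
      by (simp add: algebra_simps)
    finally have R: "gf_from k (Suc j) = (fps_X ^ Suc j * I - Y * I) * gf k" .
    show ?thesis
      unfolding part_defect_def Y_def[symmetric] I_def[symmetric] R YI by (simp add: algebra_simps)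
  qed
  moreover have "coeff_sums (\<lambda>j. fps_X ^ Suc j * (1 - fps_X) * gf k - gf_from k (Suc j) * (1 - fps_X))
      (fps_X * gf k - (gf k - 1) * (1 - fps_X))"
    by (intro coeff_sums_diff coeff_sums_mult coeff_sums_telescope coeff_sums_gf_from assms)
  moreover have "fps_X * gf k - (gf k - 1) * (1 - fps_X) = (2 * fps_X - 1) * gf k + (1 - fps_X)"
    by (simp add: algebra_simps)
  ultimately show ?thesis by simp
qed

text \<open>
  The pole at \<open>rho k\<close> is split off. Each \<open>part_defect k j\<close> is replaced by its value at \<open>rho k\<close> plus
  \<open>X - rho k\<close> times its divided difference; the values sum to \<open>2 rho k - 1\<close>, which merges with
  \<open>1 - 2 X\<close> to \<open>2 (rho k - X)\<close>.
\<close>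

lemma gf_factorization:
  assumes "4 \<le> k"
  obtains \<Delta> where "(fps_const (rho k) - fps_X) * (2 - \<Delta>) * gf k = 1 - fps_X"
    "\<And>s. rho k \<le> s \<Longrightarrow> s \<le> 3 / 5 \<Longrightarrow> wnorm_le s \<Delta> (4 * s ^ k + 7 / 8 * (real k * s ^ k) / s)"
proof -
  define r where "r = rho k"
  note rho = rho_characterization[OF assms, folded r_def]
  have k: "0 < k" using assms by simp
  let ?\<delta> = "\<lambda>j. part_defect_quot k r (Suc j)"
  have \<delta>: "wnorm_le s (?\<delta> j) (quot_bound k s (Suc j))" if "r \<le> s" "s \<le> 3 / 5" for s j
    using that rho k by (intro wnorm_le_part_defect_quot) auto
  obtain B where B: "(\<lambda>j. quot_bound k (3 / 5) (Suc j)) sums B"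
    by (rule quot_bound_sums[OF _ order_refl assms]) (simp, erule that)
  obtain \<Delta> where \<Delta>: "coeff_sums ?\<delta> \<Delta>"
    by (rule coeff_sums_exists[OF _ \<delta>[OF rho(2) order_refl] B]) (simp, erule that)
  have "coeff_sums (\<lambda>j. (fps_const ((1 - r) * defect k (Suc j) r) + ?\<delta> j * (fps_X - fps_const r)) * gf k)
      ((fps_const (2 * r - 1) + \<Delta> * (fps_X - fps_const r)) * gf k)"
    by (intro coeff_sums_mult coeff_sums_add coeff_sums_const \<Delta> defect_rho_sums[OF assms, folded r_def])
  moreover have "fps_const ((1 - r) * defect k (Suc j) r) + ?\<delta> j * (fps_X - fps_const r) = part_defect k (Suc j)" for j
    using part_defect_quot[of r "Suc j" k] rho k by (simp add: mult.commute)
  ultimately have "(fps_const (2 * r - 1) + \<Delta> * (fps_X - fps_const r)) * gf k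
      = (2 * fps_X - 1) * gf k + (1 - fps_X)"
    using coeff_sums_unique[OF _ coeff_sums_part_defect[OF k]] by simp
  moreover have "fps_const (2 * r - 1) = 2 * fps_const r - 1"
    by (simp add: numeral_fps_const flip: fps_const_1_eq_1)
  moreover have "(fps_const r - fps_X) * (2 - \<Delta>) * gf k
      = (2 * fps_const r - 1 + \<Delta> * (fps_X - fps_const r)) * gf k - (2 * fps_X - 1) * gf k"
    by (simp add: algebra_simps)
  ultimately have "(fps_const r - fps_X) * (2 - \<Delta>) * gf k = 1 - fps_X"
    by simp
  moreover have "wnorm_le s \<Delta> (4 * s ^ k + 7 / 8 * (real k * s ^ k) / s)" if s: "r \<le> s" "s \<le> 3 / 5" for s
  proof -
    have s0: "0 < s" using s rho by simp
    obtain B where B: "(\<lambda>j. quot_bound k s (Suc j)) sums B" "B \<le> 4 * s ^ k + 7 / 8 * (real k * s ^ k) / s"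
      by (rule quot_bound_sums[OF s0 s(2) assms])
    have "wnorm_le s \<Delta> B"
      by (rule wnorm_le_coeff_sums[OF less_imp_le[OF s0] \<Delta> \<delta>[OF s] B(1)])
    then show ?thesis using B(2) by (rule wnorm_le_mono)
  qed
  ultimately show ?thesis
    by (rule that[folded r_def])
qed

lemma coefficient_partial_sum:
  fixes p q :: "real fps"
  assumes "(fps_const r - fps_X) * p = q"
  shows "r ^ Suc n * p $ n = (\<Sum>m<Suc n. q $ m * r ^ m)"
proof (induction n)
  case 0
  show ?case using assms by (auto simp: left_diff_distrib)
next
  case (Suc n)
  have q: "q $ Suc n = r * p $ Suc n - p $ n"
    using assms by (auto simp: left_diff_distrib)
  have "(\<Sum>m<Suc (Suc n). q $ m * r ^ m) = r ^ Suc n * p $ n + q $ Suc n * r ^ Suc n"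
    using Suc by (simp only: sum.lessThan_Suc[of _ "Suc n"])
  then show ?case
    unfolding q by (simp only: power_Suc left_diff_distrib) (simp add: mult_ac)
qed

text \<open>
  Here \<open>\<kappa>\<close> is the value at \<open>rho k\<close> of \<open>K = (1 - X) / (2 - \<Delta>)\<close>. It is compared with the value of
  \<open>K0 = (1 - X) / 2\<close> by estimating \<open>K - K0\<close> in the norm at \<open>rho k\<close> itself, where \<open>\<Delta>\<close> is small.
\<close>

lemma run_free_count_asymptotics:
  assumes "4 \<le> k"
  obtains \<kappa> where "\<bar>\<kappa> - (1 - rho k) / 2\<bar> \<le> 4 * (real k * rho k ^ k)"
    "\<And>n. \<bar>real (run_free_count k n) - \<kappa> / rho k ^ Suc n\<bar> \<le> 4 * (5 / 3) ^ n"
proof -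
  define r where "r = rho k"
  note rho = rho_characterization[OF assms, folded r_def]
  obtain \<Delta> where \<Delta>: "(fps_const r - fps_X) * (2 - \<Delta>) * gf k = 1 - fps_X"
    "\<And>s. r \<le> s \<Longrightarrow> s \<le> 3 / 5 \<Longrightarrow> wnorm_le s \<Delta> (4 * s ^ k + 7 / 8 * (real k * s ^ k) / s)"
    using gf_factorization[OF assms] unfolding r_def by blast
  define q where "q = fps_const (1 / 2) * \<Delta>"
  define K where "K = fps_const (1 / 2) * ((1 - fps_X ^ 1) * inverse (1 - q))"
  \<comment> \<open>\<open>4 * 81/625 + 7/8 * 324/625 / (3/5)\<close> is about \<open>1.27\<close>, well below \<open>2\<close>.\<close>
  have \<Delta>35: "wnorm_le (3 / 5) \<Delta> (13 / 10)"
    by (rule wnorm_le_mono[OF \<Delta>(2)]) (use rho three_fifths_power_bounds[OF assms] in auto)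
  have "wnorm_le (3 / 5) q (\<bar>1 / 2\<bar> * (13 / 10))"
    unfolding q_def by (intro wnorm_le_mult wnorm_le_const \<Delta>35) auto
  then have q35: "wnorm_le (3 / 5) q (13 / 20)" by simp
  then have inv: "wnorm_le (3 / 5) (inverse (1 - q)) (20 / 7)"
    using wnorm_le_inverse[of "3 / 5" q "13 / 20"] by simp
  have q_inv: "(1 - q) * inverse (1 - q) = 1"
    using wnorm_le_nth_0[OF q35] by (intro inverse_mult_eq_1') auto
  have half: "fps_const (1 / 2) * 2 = (1 :: real fps)"
    by (simp add: numeral_fps_const)
  have K: "(fps_const r - fps_X) * gf k = K"
  proof -
    have "K = fps_const (1 / 2) * (((fps_const r - fps_X) * (2 - \<Delta>) * gf k) * inverse (1 - q))"
      unfolding K_def \<Delta>(1) by simp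
    also have "\<dots> = (fps_const r - fps_X) * gf k * ((fps_const (1 / 2) * 2 - q) * inverse (1 - q))"
      unfolding q_def by (simp add: algebra_simps)
    finally show ?thesis
      unfolding half q_inv by simp
  qed
  have "wnorm_le (3 / 5) K (\<bar>1 / 2\<bar> * ((1 + (3 / 5) ^ 1) * (20 / 7)))"
    unfolding K_def by (intro wnorm_le_mult wnorm_le_const wnorm_le_diff wnorm_le_one wnorm_le_X_power inv) auto
  then have K35: "wnorm_le (3 / 5) K (12 / 5)"
    by (rule wnorm_le_mono) simp
  define \<kappa> where "\<kappa> = (\<Sum>n. K $ n * r ^ n)"
  have "\<bar>real (run_free_count k n) - \<kappa> / r ^ Suc n\<bar> \<le> 4 * (5 / 3) ^ n" for n
  proof -
    have "r ^ Suc n * real (run_free_count k n) = (\<Sum>m<Suc n. K $ m * r ^ m)"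
      using coefficient_partial_sum[OF K, of n] by (simp add: gf_def)
    then have "\<bar>\<kappa> - r ^ Suc n * real (run_free_count k n)\<bar> \<le> (r / (3 / 5)) ^ Suc n * (12 / 5)"
      using wnorm_le_tail[of r "3 / 5" K "12 / 5" "Suc n"] rho K35 unfolding \<kappa>_def by simp
    then have "\<bar>\<kappa> - r ^ Suc n * real (run_free_count k n)\<bar> / r ^ Suc n
        \<le> (r / (3 / 5)) ^ Suc n * (12 / 5) / r ^ Suc n"
      using rho by (intro divide_right_mono) auto
    moreover have "real (run_free_count k n) - \<kappa> / r ^ Suc n
        = - (\<kappa> - r ^ Suc n * real (run_free_count k n)) / r ^ Suc n"
      using rho by (simp add: field_simps)
    moreover have "\<bar>r ^ Suc n\<bar> = r ^ Suc n"
      using rho by simp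
    ultimately have "\<bar>real (run_free_count k n) - \<kappa> / r ^ Suc n\<bar> \<le> (r / (3 / 5)) ^ Suc n * (12 / 5) / r ^ Suc n"
      by (simp only: abs_divide abs_minus_cancel)
    also have "\<dots> = 4 * (5 / 3) ^ n"
      using rho by (simp add: power_divide power_mult_distrib)
    finally show ?thesis .
  qed
  moreover have "\<bar>\<kappa> - (1 - r) / 2\<bar> \<le> 4 * (real k * r ^ k)"
  proof -
    define K0 where "K0 = fps_const (1 / 2) * (1 - fps_X ^ 1 :: real fps)"
    have r0: "0 \<le> r" using rho by simp
    have "wnorm_le r \<Delta> (4 * r ^ k + 7 / 8 * (real k * r ^ k) / r)"
      using \<Delta>(2)[of r] rho by simp
    moreover have "4 * r ^ k + 7 / 8 * (real k * r ^ k) / r \<le> 11 / 4 * (real k * r ^ k)"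
    proof -
      have "4 * r ^ k \<le> real k * r ^ k"
        using assms r0 by (intro mult_right_mono) auto
      moreover have "7 / 8 * (real k * r ^ k) / r \<le> 7 / 8 * (real k * r ^ k) / (1 / 2)"
        using rho by (intro divide_left_mono) auto
      ultimately show ?thesis by simp
    qed
    ultimately have \<Delta>r: "wnorm_le r \<Delta> (11 / 4 * (real k * r ^ k))"
      by (rule wnorm_le_mono)
    have "K - K0 = fps_const (1 / 2) * ((1 - fps_X ^ 1) * ((fps_const (1 / 2) * \<Delta>) * inverse (1 - q)))"
    proof -
      have J: "1 + q * inverse (1 - q) = inverse (1 - q)"
        using q_inv by (simp add: algebra_simps)
      have "K = fps_const (1 / 2) * ((1 - fps_X ^ 1) * (1 + q * inverse (1 - q)))"
        unfolding J K_def ..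
      then show ?thesis
        unfolding K0_def q_def[symmetric] by (simp add: algebra_simps)
    qed
    moreover have "wnorm_le r \<dots> (\<bar>1 / 2\<bar> * ((1 + r ^ 1) * ((\<bar>1 / 2\<bar> * (11 / 4 * (real k * r ^ k))) * (20 / 7))))"
      using rho by (intro wnorm_le_mult wnorm_le_diff wnorm_le_one wnorm_le_const wnorm_le_X_power \<Delta>r r0 wnorm_le_radius_mono[OF r0 _ inv]) auto
    ultimately have "wnorm_le r (K - K0) (\<bar>1 / 2\<bar> * ((1 + r ^ 1) * ((\<bar>1 / 2\<bar> * (11 / 4 * (real k * r ^ k))) * (20 / 7))))"
      by simp
    moreover have "\<bar>1 / 2\<bar> * ((1 + r ^ 1) * ((\<bar>1 / 2\<bar> * (11 / 4 * (real k * r ^ k))) * (20 / 7))) \<le> 4 * (real k * r ^ k)"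
    proof -
      have "(1 + r) * (real k * r ^ k) \<le> 8 / 5 * (real k * r ^ k)"
        using rho by (intro mult_right_mono) auto
      moreover have "0 \<le> real k * r ^ k" using r0 by simp
      ultimately show ?thesis by (simp add: algebra_simps)
    qed
    ultimately have D: "wnorm_le r (K - K0) (4 * (real k * r ^ k))"
      by (rule wnorm_le_mono)
    have "(\<lambda>n. K0 $ n * r ^ n) sums ((1 - r) / 2)"
    proof -
      have "(\<lambda>n. K0 $ n * r ^ n) sums (\<Sum>n<2. K0 $ n * r ^ n)"
        by (rule sums_finite) (auto simp: K0_def)
      also have "(\<Sum>n<2. K0 $ n * r ^ n) = (1 - r) / 2"
        by (simp add: K0_def numeral_2_eq_2 field_simps)
      finally show ?thesis .
    qed
    moreover have "(\<lambda>n. K $ n * r ^ n) sums \<kappa>"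
      unfolding \<kappa>_def
      using rho by (intro summable_sums wnorm_le_eval(1)[OF r0 wnorm_le_radius_mono[OF r0 _ K35]]) auto
    ultimately have "(\<lambda>n. K $ n * r ^ n - K0 $ n * r ^ n) sums (\<kappa> - (1 - r) / 2)"
      by (intro sums_diff)
    then have "(\<Sum>n. (K - K0) $ n * r ^ n) = \<kappa> - (1 - r) / 2"
      by (simp add: left_diff_distrib sums_iff)
    then show ?thesis
      using wnorm_le_eval(2)[OF r0 D] by simp
  qed
  ultimately show ?thesis
    using that unfolding r_def by blast
qed

section \<open>The asymptotic formula\<close>

text \<open>
  Dividing \<open>\<kappa>\<close> by \<open>(1 - rho k)\<^sup>2\<close> defines \<open>1 + \<epsilon> k\<close>. The error splits into that of \<open>\<kappa>\<close> against
  \<open>(1 - rho k) / 2\<close> and that of \<open>1 / (2 (1 - rho k))\<close> against \<open>1\<close>.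
\<close>

theorem proposition4:
  shows "\<exists>\<epsilon> :: nat \<Rightarrow> real.
    \<epsilon> \<in> O(\<lambda>k. real k * 2 powi (- int k)) \<and>
    (\<exists>(c :: real) (N :: nat). \<forall>k\<ge>4. \<forall>n\<ge>N.
      \<bar>real (run_free_count k n) - rho k powi (- int n - 1) * (1 - rho k)\<^sup>2 * (1 + \<epsilon> k)\<bar>
        \<le> c * (5 / 3) ^ n)"
proof -
  have "\<exists>e. \<bar>e\<bar> \<le> 90 * (real k / 2 ^ k) \<and>
      (\<forall>n. \<bar>real (run_free_count k n) - rho k powi (- int n - 1) * (1 - rho k)\<^sup>2 * (1 + e)\<bar> \<le> 4 * (5 / 3) ^ n)"
    if k: "4 \<le> k" for k
  proof -
    define r where "r = rho k"
    note rho = rho_characterization[OF k, folded r_def]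
    obtain \<kappa> where \<kappa>: "\<bar>\<kappa> - (1 - r) / 2\<bar> \<le> 4 * (real k * r ^ k)"
      "\<And>n. \<bar>real (run_free_count k n) - \<kappa> / r ^ Suc n\<bar> \<le> 4 * (5 / 3) ^ n"
      using run_free_count_asymptotics[OF k] unfolding r_def by blast
    define e where "e = \<kappa> / (1 - r)\<^sup>2 - 1"
    have "r powi (- int n - 1) * (1 - r)\<^sup>2 * (1 + e) = \<kappa> / r ^ Suc n" for n
    proof -
      have "- int n - 1 = - int (Suc n)" by simp
      then have "r powi (- int n - 1) = 1 / r ^ Suc n"
        by (simp only: power_int_minus power_int_of_nat inverse_eq_divide)
      moreover have "(1 - r)\<^sup>2 * (1 + e) = \<kappa>"
        unfolding e_def using rho by simp
      ultimately show ?thesis by (simp add: mult.assoc)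
    qed
    moreover have "\<bar>e\<bar> \<le> 90 * (real k / 2 ^ k)"
    proof -
      have "\<bar>e\<bar> = \<bar>(\<kappa> - (1 - r) / 2) / (1 - r)\<^sup>2 + (2 * r - 1) / (2 * (1 - r))\<bar>"
      proof -
        have "\<kappa> / d\<^sup>2 - 1 = (\<kappa> - d / 2) / d\<^sup>2 + (1 - 2 * d) / (2 * d)" if "d \<noteq> 0" for d :: real
          using that by (simp add: field_simps power2_eq_square)
        from this[of "1 - r"] show ?thesis
          unfolding e_def using rho by simp
      qed
      also have "\<dots> \<le> \<bar>\<kappa> - (1 - r) / 2\<bar> / (1 - r)\<^sup>2 + (2 * r - 1) / (2 * (1 - r))"
        using rho by (intro order_trans[OF abs_triangle_ineq]) (simp add: abs_divide)
      also have "\<dots> \<le> 4 * (real k * r ^ k) / (2 / 5)\<^sup>2 + r ^ k / (4 / 5)"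
        using rho \<kappa>(1) defect_rho_sums(2)[OF k, folded r_def]
        by (intro add_mono frac_le power_mono) auto
      also have "\<dots> \<le> 30 * (real k * r ^ k)"
      proof -
        have "1 * r ^ k \<le> real k * r ^ k"
          using k rho by (intro mult_right_mono) auto
        moreover have "0 \<le> real k * r ^ k" using rho by simp
        ultimately show ?thesis by (simp add: power_divide)
      qed
      also have "\<dots> \<le> 30 * (real k * (3 / 2 ^ k))"
        using rho_power_le[OF k, folded r_def] by (intro mult_left_mono) auto
      finally show ?thesis by simp
    qed
    ultimately show ?thesis
      using \<kappa>(2) unfolding r_def by (intro exI[of _ e]) auto
  qed
  then have "\<forall>k\<in>{4..}. \<exists>e. \<bar>e\<bar> \<le> 90 * (real k / 2 ^ k) \<and>
      (\<forall>n. \<bar>real (run_free_count k n) - rho k powi (- int n - 1) * (1 - rho k)\<^sup>2 * (1 + e)\<bar> \<le> 4 * (5 / 3) ^ n)"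
    by blast
  from bchoice[OF this] obtain \<epsilon> where \<epsilon>: "\<And>k. 4 \<le> k \<Longrightarrow> \<bar>\<epsilon> k\<bar> \<le> 90 * (real k / 2 ^ k)"
    "\<And>k n. 4 \<le> k \<Longrightarrow> \<bar>real (run_free_count k n) - rho k powi (- int n - 1) * (1 - rho k)\<^sup>2 * (1 + \<epsilon> k)\<bar>
        \<le> 4 * (5 / 3) ^ n"
    by auto
  have "\<epsilon> \<in> O(\<lambda>k. real k * 2 powi (- int k))"
  proof (rule bigoI)
    show "\<forall>\<^sub>F k in at_top. norm (\<epsilon> k) \<le> 90 * norm (real k * 2 powi (- int k))"
      using eventually_ge_at_top[of 4]
      by eventually_elim (use \<epsilon>(1) in \<open>simp add: power_int_minus divide_inverse\<close>)
  qed
  then show ?thesis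
    using \<epsilon>(2) by blast
qed

end
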